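(* Let $\Phi$ and $\Psi$ be finite Young functions, positive on $(0,\infty)$, with $q_\Phi=q_\Psi<\infty$, and let $$F(p;\Phi)=\bigg[\sum_{k\ge0}2^{-\frac k2}\,\Phi(2^k)^{\frac1{2p}}\bigg]^2,\qquad F(p;\Psi)=\bigg[\sum_{k\ge0}2^{-\frac k2}\,\Psi(2^k)^{\frac1{2p}}\bigg]^2\qquad(p>q_\Phi).$$ Assume that $F(p;\Phi)\to\infty$ as $p\to q_\Phi^+$ and that $\Psi\in o(\Phi)$. Then $F(p;\Psi)\in o\big(F(p;\Phi)\big)$ as $p\to q_\Phi^+$, that is, $$\lim_{p\to q_\Phi^+}\frac{F(p;\Psi)}{F(p;\Phi)}=0.$$
   Context: A Young function is a non-decreasing convex $\Phi:[0,\infty)\to[0,\infty]$ with $\Phi(0)=0$ and $\lim_{t\to\infty}\Phi(t)=\infty$. For a finite Young function $\Phi$ positive on $(0,\infty)$, let $M_\Phi(t)=\sup_{s>0}\Phi(st)/\Phi(s)$; the upper Matuszewska-Orlicz index is $q_\Phi=\lim_{t\to\infty}\frac{\log M_\Phi(t)}{\log t}$. The notation $\Psi\in o(\Phi)$ means $\lim_{s\to\infty}\Psi(s)/\Phi(s)=0$. The quantity $F(p;\Phi)$ is the interpolation constant $$\inf_{k_0}\Big[\sum_{k>k_0}\big(2^{-k}(\Phi(2^k)+\Phi_2(2^{k_0}))^{1/p}\big)^{1/2}+\sum_{k\le k_0}\big(2^{-k}\Phi_2(2^k)^{1/p}\big)^{1/2}\Big]^2$$ in the case where $\Phi_2$ is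 the $\{0,\infty\}$-valued Young function $\chi_\infty$ generating $L_\infty$ (the strong type $(\infty,\infty)$ endpoint). *)

theory Defs
  imports "HOL-Analysis.Analysis"
begin

text \<open>
  Functions on \<open>[0,\<infinity>)\<close> are rendered as functions \<open>real \<Rightarrow> real\<close> whose values at negative
  arguments play no role. For a real-valued function, \<open>\<Phi>(t) \<rightarrow> \<infinity>\<close> is divergence to \<open>at_top\<close>.
\<close>

definition finite_young_function :: "(real \<Rightarrow> real) \<Rightarrow> bool" where
  "finite_young_function \<Phi> \<longleftrightarrow>
     (\<forall>t\<ge>0. 0 \<le> \<Phi> t) \<and>
     mono_on {0..} \<Phi> \<and> convex_on {0..} \<Phi> \<and> \<Phi> 0 = 0 \<and>
     filterlim \<Phi> at_top at_top"

text \<open>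
  The supremum below may be infinite, so it and its logarithm are extended real numbers.
\<close>

definition dilation_sup :: "(real \<Rightarrow> real) \<Rightarrow> real \<Rightarrow> ereal" where
  "dilation_sup \<Phi> t = (SUP s\<in>{0<..}. ereal (\<Phi> (s * t) / \<Phi> s))"

definition ereal_log :: "ereal \<Rightarrow> ereal" where
  "ereal_log x = (if x \<le> 0 then -\<infinity> else if x = \<infinity> then \<infinity> else ereal (ln (real_of_ereal x)))"

text \<open>
  For \<open>\<Phi>\<close> as in the theorem the limit exists in the extended reals: \<open>dilation_sup \<Phi>\<close> is
  submultiplicative and monotone, and it is either infinite throughout \<open>(1,\<infinity>)\<close> or finite there.
\<close>

definition upper_index :: "(real \<Rightarrow> real) \<Rightarrow> ereal" where
  "upper_index \<Phi> = Lim at_top (\<lambda>t. ereal_log (dilation_sup \<Phi> t) / ereal (ln t))"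

text \<open>
  The series converges whenever \<open>p > upper_index \<Phi>\<close>, since then \<open>\<Phi>(2\<^sup>k) \<le> C 2\<^bsup>kr\<^esup>\<close> for
  some \<open>r < p\<close>; only such \<open>p\<close> are used.
\<close>

definition F :: "real \<Rightarrow> (real \<Rightarrow> real) \<Rightarrow> real" where
  "F p \<Phi> = (\<Sum>k::nat. 2 powr (- real k / 2) * \<Phi> (2 ^ k) powr (1 / (2 * p)))\<^sup>2"

end

theory Submission
  imports Defs
begin

text \<open>
  Since \<open>\<Psi> \<le> \<delta> \<Phi>\<close> beyond some point, the series of \<open>\<Psi>\<close> is, up to finitely many terms that stay
  bounded in \<open>p\<close>, at most \<open>\<delta> powr (1 / (2 p))\<close> times the series of \<open>\<Phi>\<close>; for bounded \<open>p\<close> this factor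
  is small with \<open>\<delta>\<close>, and the bounded part is negligible because \<open>F p \<Phi>\<close> diverges. The argument
  requires the series of \<open>\<Phi>\<close> to converge for \<open>p > upper_index \<Phi>\<close>, which rests on Fekete's lemma:
  \<open>ln (dilation_sup \<Phi> t) / ln t\<close> converges to its infimum over \<open>t > 1\<close>.
\<close>

section \<open>Growth bounds from dilation\<close>

text \<open>Iterating the dilation by \<open>a\<close> until \<open>a ^ n\<close> passes
  \<open>t\<close> and then using monotonicity gives a power bound. Rounding
  \<open>ln t / ln a\<close> up to an integer costs at most one extra factor \<open>c\<close>, hence
  the \<open>+ 1\<close> in the exponent.\<close>

lemma dilation_bound:
  fixes \<Phi> :: "real \<Rightarrow> real"
  assumes mono: "mono_on {0..} \<Phi>" and nonneg: "\<And>s. s > 0 \<Longrightarrow> \<Phi> s \<ge> 0"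
    and a: "a > 1" and c: "c \<ge> 1"
    and dil: "\<And>s. s > 0 \<Longrightarrow> \<Phi> (s * a) \<le> c * \<Phi> s"
    and t: "t \<ge> 1" and s: "s > 0"
  shows "\<Phi> (s * t) \<le> c powr (ln t / ln a + 1) * \<Phi> s"
proof -
  have iter: "\<Phi> (s * a ^ n) \<le> c ^ n * \<Phi> s" for n
  proof (induction n)
    case (Suc n)
    have "\<Phi> (s * a ^ Suc n) = \<Phi> ((s * a ^ n) * a)" by (simp add: algebra_simps)
    also have "\<dots> \<le> c * \<Phi> (s * a ^ n)" using dil s a by simp
    also have "\<dots> \<le> c * (c ^ n * \<Phi> s)" using Suc c by (intro mult_left_mono) auto
    finally show ?case by (simp add: algebra_simps)
  qed simp
  define n where "n = nat \<lceil>ln t / ln a\<rceil>"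
  have q: "ln t / ln a \<ge> 0" using t a by simp
  have n1: "ln t / ln a \<le> real n" and n2: "real n \<le> ln t / ln a + 1"
    unfolding n_def using q by linarith+
  have "ln t \<le> real n * ln a" using n1 a by (simp add: field_simps)
  then have "ln t \<le> ln (a ^ n)" using a by (simp add: ln_realpow)
  then have "t \<le> a ^ n" using t a by simp
  then have "\<Phi> (s * t) \<le> \<Phi> (s * a ^ n)" using s t a by (intro mono_onD[OF mono]) auto
  also have "\<dots> \<le> c ^ n * \<Phi> s" by (rule iter)
  also have "c ^ n = c powr real n" using c by (simp add: powr_realpow)
  also have "c powr real n * \<Phi> s \<le> c powr (ln t / ln a + 1) * \<Phi> s"
    using n2 c nonneg[OF s] by (intro mult_right_mono powr_mono) auto
  finally show ?thesis .
qed

lemma convex_on_scale_ge: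
  fixes \<Phi> :: "real \<Rightarrow> real"
  assumes "convex_on {0..} \<Phi>" "\<Phi> 0 = 0" "t \<ge> 1" "s \<ge> 0"
  shows "t * \<Phi> s \<le> \<Phi> (s * t)"
proof -
  have "\<Phi> ((1 - 1/t) *\<^sub>R 0 + (1/t) *\<^sub>R (s * t)) \<le> (1 - 1/t) * \<Phi> 0 + (1/t) * \<Phi> (s * t)"
    using assms by (intro convex_onD) auto
  then show ?thesis using assms by (simp add: field_simps)
qed

text \<open>The single point \<open>s = 1\<close> suffices, by convexity. The bound keeps the
  supremum positive, so that its logarithm is meaningful, and later forces the index to be at least
  1.\<close>

lemma dilation_sup_ge:
  assumes "finite_young_function \<Phi>" "\<forall>t>0. \<Phi> t > 0" "t \<ge> 1"
  shows "ereal t \<le> dilation_sup \<Phi> t"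
proof -
  have "t * \<Phi> 1 \<le> \<Phi> (1 * t)"
    using assms by (intro convex_on_scale_ge) (auto simp: finite_young_function_def)
  moreover have "\<Phi> 1 > 0" using assms by simp
  ultimately have "ereal t \<le> ereal (\<Phi> (1 * t) / \<Phi> 1)" by (simp add: field_simps)
  also have "\<dots> \<le> dilation_sup \<Phi> t" unfolding dilation_sup_def by (rule SUP_upper) simp
  finally show ?thesis .
qed

lemma dilation_sup_le_iff:
  assumes "\<forall>t>0. \<Phi> t > 0"
  shows "dilation_sup \<Phi> t \<le> ereal c \<longleftrightarrow> (\<forall>s>0. \<Phi> (s * t) \<le> c * \<Phi> s)"
  using assms by (auto simp: dilation_sup_def SUP_le_iff pos_divide_le_eq)

section \<open>The upper index as an infimum\<close>

text \<open>Both conclusions follow from identifying the limit with the infimum of the quotients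
  over \<open>t > 1\<close>: each quotient is at least 1, and a \<open>p\<close> above the infimum
  exceeds the quotient at some \<open>a\<close>, where \<open>c\<close> is the dilation supremum at
  \<open>a\<close>.\<close>

lemma upper_index_finite:
  assumes Y: "finite_young_function \<Phi>" and pos: "\<forall>t>0. \<Phi> t > 0" and fin: "upper_index \<Phi> < \<infinity>"
  shows upper_index_ge_1: "1 \<le> real_of_ereal (upper_index \<Phi>)"
    and upper_index_less_dilation:
      "real_of_ereal (upper_index \<Phi>) < p \<Longrightarrow>
        \<exists>a>1. \<exists>c\<ge>1. ln c / ln a < p \<and> (\<forall>s>0. \<Phi> (s * a) \<le> c * \<Phi> s)"
proof -
  define m where "m t = real_of_ereal (dilation_sup \<Phi> t)" for t
  have mono: "mono_on {0..} \<Phi>" and nonneg: "\<And>s. s > 0 \<Longrightarrow> \<Phi> s \<ge> 0"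
    using Y by (auto simp: finite_young_function_def)
  \<comment> \<open>If the supremum were infinite on all of \<open>t > 1\<close>, the quotient would
    be constantly infinite there and so would be its limit.\<close>
  have ex: "\<exists>t0>1. dilation_sup \<Phi> t0 < \<infinity>"
  proof (rule ccontr)
    assume "\<not> ?thesis"
    then have inf: "dilation_sup \<Phi> t = \<infinity>" if "t > 1" for t using that by auto
    have "\<forall>\<^sub>F t in at_top. ereal_log (dilation_sup \<Phi> t) / ereal (ln t) = \<infinity>"
      using eventually_gt_at_top[of 1] by eventually_elim (simp add: inf ereal_log_def)
    then have "((\<lambda>t. ereal_log (dilation_sup \<Phi> t) / ereal (ln t)) \<longlongrightarrow> \<infinity>) (at_top :: real filter)"
      by (rule tendsto_eventually)
    then have "upper_index \<Phi> = \<infinity>"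
      unfolding upper_index_def by (intro tendsto_Lim) auto
    then show False using fin by simp
  qed
  then obtain t0 where t0: "t0 > 1" "dilation_sup \<Phi> t0 < \<infinity>" by auto
  \<comment> \<open>\<open>real_of_ereal\<close> sends infinite values to 0, so \<open>m\<close>
    represents the supremum only where that is known to be finite.\<close>
  have m_eqI: "dilation_sup \<Phi> t = ereal (m t)" if "dilation_sup \<Phi> t < \<infinity>" "t \<ge> 1" for t
  proof -
    have "dilation_sup \<Phi> t \<noteq> -\<infinity>" using dilation_sup_ge[OF Y pos that(2)] by auto
    then show ?thesis using that(1) unfolding m_def by (cases "dilation_sup \<Phi> t") auto
  qed
  \<comment> \<open>Finiteness is required at \<open>a\<close> only. With \<open>a = t0\<close> this
    spreads finiteness to every \<open>t \<ge> 1\<close>; afterwards, with arbitrary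
    \<open>a\<close>, it serves as the subadditivity estimate for Fekete's lemma.\<close>
  have sub: "dilation_sup \<Phi> t \<le> ereal (m a powr (ln t / ln a + 1))"
    if a: "a > 1" "dilation_sup \<Phi> a < \<infinity>" and t: "t \<ge> 1" for a t
  proof -
    have e: "dilation_sup \<Phi> a = ereal (m a)" using m_eqI a by simp
    then have "m a \<ge> 1" using dilation_sup_ge[OF Y pos, of a] a by simp
    moreover have "\<forall>s>0. \<Phi> (s * a) \<le> m a * \<Phi> s" using e dilation_sup_le_iff[OF pos, of a "m a"] by simp
    ultimately show ?thesis
      unfolding dilation_sup_le_iff[OF pos] using dilation_bound[OF mono nonneg a(1) _ _ t] by blast
  qed
  have m_fin: "dilation_sup \<Phi> t < \<infinity>" if "t \<ge> 1" for t
    using sub[OF t0 that] by (metis ereal_infty_less(1) ereal_infty_less_eq(1) PInfty_neq_ereal(1))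
  have m_eq: "dilation_sup \<Phi> t = ereal (m t)" if "t \<ge> 1" for t
    using m_eqI m_fin that by blast
  have m_ge: "t \<le> m t" if "t \<ge> 1" for t
    using dilation_sup_ge[OF Y pos that] m_eq[OF that] by simp
  have m_sub: "ln (m t) \<le> (ln t / ln a + 1) * ln (m a)" if a: "a > 1" and t: "t \<ge> 1" for a t
  proof -
    have "m t \<le> m a powr (ln t / ln a + 1)" using sub[OF a m_fin t] a m_eq[OF t] by simp
    moreover have "m t > 0" using m_ge[OF t] t by simp
    ultimately have "ln (m t) \<le> ln (m a powr (ln t / ln a + 1))"
      by (rule ln_mono)
    also have "\<dots> = (ln t / ln a + 1) * ln (m a)" using m_ge[of a] a by (simp add: ln_powr)
    finally show ?thesis .
  qed
  define L where "L t = ln (m t) / ln t" for t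
  define I where "I = (INF t\<in>{1<..}. L t)"
  have L1: "1 \<le> L t" if "t > 1" for t
    using m_ge[of t] that by (simp add: L_def)
  have bdd: "bdd_below (L ` {1<..})" using L1 by (intro bdd_belowI[of _ 1]) auto
  have I1: "1 \<le> I" unfolding I_def using L1 by (intro cINF_greatest) auto
  have Iless: "\<exists>a>1. L a < p" if "I < p" for p
    using that cINF_less_iff[of "{1<..}" L p] bdd unfolding I_def by auto
  have tL: "(L \<longlongrightarrow> I) at_top"
  proof (rule order_tendstoI)
    fix y assume "y < I"
    then have "y < L t" if "t > 1" for t
      using cINF_lower[OF bdd, of t] that unfolding I_def by simp
    then show "\<forall>\<^sub>F t in at_top. y < L t"
      using eventually_gt_at_top[of 1] by (rule eventually_mono[rotated]) auto
  next
    fix y assume "I < y"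
    then obtain a where a: "a > 1" "L a < y" using Iless by blast
    \<comment> \<open>The rounding cost \<open>ln (m a)\<close> vanishes after division by
      \<open>ln t\<close>, so \<open>L t\<close> is eventually below any number above
      \<open>L a\<close>.\<close>
    have "((\<lambda>t. ln (m a) / ln t) \<longlongrightarrow> 0) at_top"
      by (intro real_tendsto_divide_at_top[OF tendsto_const] ln_at_top)
    then have "\<forall>\<^sub>F t in at_top. ln (m a) / ln t < y - L a"
      using a by (intro order_tendstoD) auto
    then show "\<forall>\<^sub>F t in at_top. L t < y" using eventually_gt_at_top[of 1]
    proof eventually_elim
      case (elim t)
      have "L t \<le> ((ln t / ln a + 1) * ln (m a)) / ln t"
        unfolding L_def using m_sub[OF a(1), of t] elim by (intro divide_right_mono) auto
      also have "\<dots> = L a + ln (m a) / ln t"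
        using elim a unfolding L_def by (simp add: field_simps)
      finally show ?case using elim by simp
    qed
  qed
  have L_eq: "\<forall>\<^sub>F t in at_top. ereal (L t) = ereal_log (dilation_sup \<Phi> t) / ereal (ln t)"
    using eventually_gt_at_top[of 1]
  proof eventually_elim
    case (elim t)
    have "m t > 0" using m_ge[of t] elim by simp
    then show ?case using m_eq[of t] elim by (simp add: ereal_log_def L_def)
  qed
  have "((\<lambda>t. ereal (L t)) \<longlongrightarrow> ereal I) at_top" using tL by simp
  then have "((\<lambda>t. ereal_log (dilation_sup \<Phi> t) / ereal (ln t)) \<longlongrightarrow> ereal I) at_top"
    using L_eq by (rule Lim_transform_eventually)
  then have UI: "upper_index \<Phi> = ereal I"
    unfolding upper_index_def by (intro tendsto_Lim) auto
  then show "1 \<le> real_of_ereal (upper_index \<Phi>)" using I1 by simp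
  assume "real_of_ereal (upper_index \<Phi>) < p"
  then obtain a where a: "a > 1" "L a < p" using Iless UI by auto
  have "\<forall>s>0. \<Phi> (s * a) \<le> m a * \<Phi> s"
    using m_eq[of a] a dilation_sup_le_iff[OF pos, of a "m a"] by simp
  moreover have "m a \<ge> 1" using m_ge[of a] a by simp
  ultimately show "\<exists>a>1. \<exists>c\<ge>1. ln c / ln a < p \<and> (\<forall>s>0. \<Phi> (s * a) \<le> c * \<Phi> s)"
    using a unfolding L_def by blast
qed

section \<open>Convergence of the series\<close>

text \<open>A \<open>p\<close> above the index leaves room for a growth exponent
  \<open>r < p\<close> of \<Phi> along the powers of 2, which yields a geometric majorant.\<close>

lemma summable_F:
  assumes Y: "finite_young_function \<Phi>" and pos: "\<forall>t>0. \<Phi> t > 0" and fin: "upper_index \<Phi> < \<infinity>"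
    and p: "real_of_ereal (upper_index \<Phi>) < p"
  shows "summable (\<lambda>k::nat. 2 powr (- real k / 2) * \<Phi> (2 ^ k) powr (1 / (2 * p)))"
proof -
  have p0: "p > 0" using upper_index_ge_1[OF Y pos fin] p by simp
  obtain a c where a: "a > 1" "c \<ge> 1" and r: "ln c / ln a < p"
    and dil: "\<forall>s>0. \<Phi> (s * a) \<le> c * \<Phi> s"
    using upper_index_less_dilation[OF Y pos fin p] by blast
  define r where "r = ln c / ln a"
  \<comment> \<open>The ratio of the majorant: \<open>r / (2 * p)\<close> comes from the growth of
    \<Phi>, \<open>- 1 / 2\<close> from the weight. It is below 1 exactly because
    \<open>r < p\<close>.\<close>
  define x where "x = 2 powr (r / (2 * p) - 1 / 2 :: real)"
  have "r / (2 * p) < 1 / 2" using r p0 unfolding r_def[symmetric] by (simp add: pos_divide_less_eq)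
  then have x1: "x < 1" unfolding x_def using powr_less_cancel_iff[of 2 _ 0] by simp
  have x0: "x \<ge> 0" unfolding x_def by simp
  have b: "\<Phi> (2 ^ k) \<le> 2 powr (real k * r) * (c * \<Phi> 1)" for k :: nat
  proof -
    have "\<Phi> (1 * 2 ^ k) \<le> c powr (ln (2 ^ k) / ln a + 1) * \<Phi> 1"
      using Y pos a dil by (intro dilation_bound) (auto simp: finite_young_function_def)
    also have "c powr (ln (2 ^ k) / ln a + 1) = c powr (ln (2 ^ k) / ln a) * c"
      using a by (simp add: powr_add)
    \<comment> \<open>Change of base: both sides are the exponential of
      \<open>k * ln 2 * ln c / ln a\<close>.\<close>
    also have "c powr (ln (2 ^ k) / ln a) = 2 powr (real k * r)"
      using a by (simp add: powr_def r_def ln_realpow)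
    finally show ?thesis by (simp add: mult.assoc)
  qed
  show ?thesis
  proof (rule summable_comparison_test)
    show "summable (\<lambda>k. (c * \<Phi> 1) powr (1 / (2 * p)) * x ^ k)"
      using x0 x1 by (intro summable_mult summable_geometric) simp
    have "2 powr (- real k / 2) * \<Phi> (2 ^ k) powr (1 / (2 * p))
        \<le> (c * \<Phi> 1) powr (1 / (2 * p)) * x ^ k" for k :: nat
    proof -
      have "\<Phi> (2 ^ k) powr (1 / (2 * p)) \<le> (2 powr (real k * r) * (c * \<Phi> 1)) powr (1 / (2 * p))"
        using b[of k] p0 pos by (intro powr_mono2) (auto intro: less_imp_le)
      also have "\<dots> = 2 powr (real k * r / (2 * p)) * (c * \<Phi> 1) powr (1 / (2 * p))"
        using a pos by (simp add: powr_mult powr_powr less_imp_le)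
      finally have "2 powr (- real k / 2) * \<Phi> (2 ^ k) powr (1 / (2 * p)) \<le>
          2 powr (- real k / 2) * (2 powr (real k * r / (2 * p)) * (c * \<Phi> 1) powr (1 / (2 * p)))"
        by (intro mult_left_mono) auto
      also have "\<dots> = (c * \<Phi> 1) powr (1 / (2 * p)) * 2 powr (real k * (r / (2 * p) - 1 / 2))"
        by (simp add: powr_add[symmetric] algebra_simps)
      also have "2 powr (real k * (r / (2 * p) - 1 / 2)) = x ^ k"
        unfolding x_def by (simp add: powr_powr powr_realpow[symmetric] mult.commute)
      finally show ?thesis .
    qed
    then show "\<exists>N. \<forall>k\<ge>N. norm (2 powr (- real k / 2) * \<Phi> (2 ^ k) powr (1 / (2 * p)))
        \<le> (c * \<Phi> 1) powr (1 / (2 * p)) * x ^ k" by simp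
  qed
qed

section \<open>Comparison of the two series\<close>

theorem lemma2:
  fixes \<Phi> \<Psi> :: "real \<Rightarrow> real"
  assumes "finite_young_function \<Phi>" and "finite_young_function \<Psi>"
    and "\<forall>t>0. \<Phi> t > 0" and "\<forall>t>0. \<Psi> t > 0"
    and "upper_index \<Phi> = upper_index \<Psi>" and "upper_index \<Phi> < \<infinity>"
    and "filterlim (\<lambda>p. F p \<Phi>) at_top (at_right (real_of_ereal (upper_index \<Phi>)))"
    and "((\<lambda>s. \<Psi> s / \<Phi> s) \<longlongrightarrow> 0) at_top"
  shows "((\<lambda>p. F p \<Psi> / F p \<Phi>) \<longlongrightarrow> 0) (at_right (real_of_ereal (upper_index \<Phi>)))"
proof -
  define q where "q = real_of_ereal (upper_index \<Phi>)"
  define u where "u G p k = 2 powr (- real k / 2) * G (2 ^ k) powr (1 / (2 * p))"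
    for G :: "real \<Rightarrow> real" and p and k :: nat
  define S where "S G p = (\<Sum>k. u G p k)" for G p
  have F_S: "F p G = (S G p)\<^sup>2" for p G by (simp add: F_def S_def u_def)
  have q1: "q \<ge> 1" unfolding q_def by (rule upper_index_ge_1) fact+
  have u0: "u G p k \<ge> 0" for G p k by (simp add: u_def)
  \<comment> \<open>The sum of a divergent series is an unspecified value, so convergence has to
    precede any estimate of \<open>S\<close>. For \<Psi> the same range of \<open>p\<close> works
    because the indices agree.\<close>
  have sum\<Phi>: "summable (u \<Phi> p)" if "p > q" for p
    using summable_F[OF assms(1,3,6)] that by (simp add: q_def u_def[abs_def])
  have sum\<Psi>: "summable (u \<Psi> p)" if "p > q" for p
    using summable_F[OF assms(2,4)] assms(5,6) that by (simp add: q_def u_def[abs_def])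
  have S0: "S \<Phi> p \<ge> 0" "S \<Psi> p \<ge> 0" if "p > q" for p
    unfolding S_def using sum\<Phi> sum\<Psi> that u0 by (auto intro!: suminf_nonneg)
  \<comment> \<open>The point is that \<open>C\<close> is independent of \<open>p\<close>; the cap
    \<open>p < q + 1\<close> bounds the exponent \<open>1 / (2 * p)\<close> away from 0.\<close>
  have split: "\<exists>C. \<forall>p. q < p \<and> p < q + 1 \<longrightarrow> S \<Psi> p \<le> C + e * S \<Phi> p" if "e > 0" for e
  proof -
    \<comment> \<open>Chosen so that the power \<open>1 / (2 * (q + 1))\<close> of \<open>d\<close>
      is \<open>min e 1\<close>. The minimum ensures \<open>d \<le> 1\<close>, so the larger
      exponent \<open>1 / (2 * p)\<close> only decreases the value.\<close>
    define d where "d = min e 1 powr (2 * (q + 1))"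
    have d: "0 < d" "d \<le> 1" using that q1 by (auto simp: d_def intro!: powr_le1)
    have d_le: "d powr (1 / (2 * p)) \<le> e" if "q < p" "p < q + 1" for p
    proof -
      have "d powr (1 / (2 * p)) \<le> d powr (1 / (2 * (q + 1)))"
        using d that q1 by (intro powr_mono') (auto simp: field_simps)
      also have "\<dots> = min e 1" using \<open>e > 0\<close> q1 by (simp add: d_def powr_powr)
      finally show ?thesis by simp
    qed
    have "\<forall>\<^sub>F s in at_top. \<Psi> s / \<Phi> s < d" using assms(8) d by (intro order_tendstoD) auto
    then obtain B where B: "\<And>s. s \<ge> B \<Longrightarrow> \<Psi> s / \<Phi> s < d" by (auto simp: eventually_at_top_linorder)
    obtain K :: nat where K: "B < 2 ^ K" using real_arch_pow[of 2 B] by auto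
    define C where "C = (\<Sum>k<K. max 1 (\<Psi> (2 ^ k)))"
    \<comment> \<open>Since \<open>p > q \<ge> 1\<close>, the exponent is below 1; raising the base
      to at least 1 then allows replacing the exponent by 1, which removes \<open>p\<close> from the
      bound.\<close>
    have head: "u \<Psi> p k \<le> max 1 (\<Psi> (2 ^ k))" if "p > q" for p k
    proof -
      have "\<Psi> (2 ^ k) powr (1 / (2 * p)) \<le> max 1 (\<Psi> (2 ^ k)) powr (1 / (2 * p))"
        using assms(4) that q1 by (intro powr_mono2) (auto intro: less_imp_le)
      also have "\<dots> \<le> max 1 (\<Psi> (2 ^ k)) powr 1"
        using that q1 by (intro powr_mono) auto
      finally have "\<Psi> (2 ^ k) powr (1 / (2 * p)) \<le> max 1 (\<Psi> (2 ^ k))" by simp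
      moreover have "2 powr (- real k / 2) \<le> (1::real)"
        using powr_mono[of "- real k / 2" 0 2] by simp
      ultimately have "u \<Psi> p k \<le> 1 * max 1 (\<Psi> (2 ^ k))"
        unfolding u_def by (intro mult_mono) auto
      then show ?thesis by simp
    qed
    have tail: "u \<Psi> p k \<le> e * u \<Phi> p k" if "q < p" "p < q + 1" "k \<ge> K" for p k
    proof -
      have "(2::real) ^ K \<le> 2 ^ k" using that by simp
      then have "\<Psi> (2 ^ k) / \<Phi> (2 ^ k) < d" using K by (intro B) linarith
      then have "\<Psi> (2 ^ k) \<le> d * \<Phi> (2 ^ k)" using assms(3) by (simp add: pos_divide_less_eq less_imp_le)
      then have "\<Psi> (2 ^ k) powr (1 / (2 * p)) \<le> (d * \<Phi> (2 ^ k)) powr (1 / (2 * p))"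
        using assms(4) that q1 by (intro powr_mono2) (auto intro: less_imp_le)
      also have "\<dots> = d powr (1 / (2 * p)) * \<Phi> (2 ^ k) powr (1 / (2 * p))"
        using d assms(3) by (simp add: powr_mult less_imp_le)
      also have "\<dots> \<le> e * \<Phi> (2 ^ k) powr (1 / (2 * p))"
        using d_le that by (intro mult_right_mono) auto
      finally show ?thesis unfolding u_def
        by (subst mult.left_commute) (intro mult_left_mono, auto)
    qed
    have "S \<Psi> p \<le> C + e * S \<Phi> p" if p: "q < p" "p < q + 1" for p
    proof -
      have "S \<Psi> p = (\<Sum>k. u \<Psi> p (k + K)) + (\<Sum>k<K. u \<Psi> p k)"
        unfolding S_def using sum\<Psi> p by (intro suminf_split_initial_segment) auto
      also have "(\<Sum>k<K. u \<Psi> p k) \<le> C" unfolding C_def using head p by (intro sum_mono) auto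
      also have "(\<Sum>k. u \<Psi> p (k + K)) \<le> (\<Sum>k. e * u \<Phi> p (k + K))"
        using tail p sum\<Phi>[of p] sum\<Psi>[of p]
        by (intro suminf_le summable_mult) (auto simp: summable_iff_shift)
      also have "\<dots> = e * (\<Sum>k. u \<Phi> p (k + K))"
        using sum\<Phi>[of p] p by (intro suminf_mult) (auto simp: summable_iff_shift)
      \<comment> \<open>The omitted initial terms are nonnegative.\<close>
      also have "(\<Sum>k. u \<Phi> p (k + K)) \<le> S \<Phi> p"
        using suminf_split_initial_segment[of "u \<Phi> p" K] sum\<Phi>[of p] p u0
        unfolding S_def by (simp add: sum_nonneg)
      finally show ?thesis using \<open>e > 0\<close> by simp
    qed
    then show ?thesis by blast
  qed
  have near: "\<forall>\<^sub>F p in at_right q. q < p \<and> p < q + 1"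
    unfolding eventually_at_right_field by (intro exI[of _ "q + 1"]) auto
  have ratio: "((\<lambda>p. S \<Psi> p / S \<Phi> p) \<longlongrightarrow> 0) (at_right q)"
  proof (rule tendstoI)
    fix e :: real assume e: "e > 0"
    obtain C where C: "\<And>p. q < p \<Longrightarrow> p < q + 1 \<Longrightarrow> S \<Psi> p \<le> C + e / 2 * S \<Phi> p"
      using split[of "e / 2"] e by auto
    \<comment> \<open>Beyond \<open>2 * C / e\<close> the constant \<open>C\<close> is less than
      \<open>e / 2\<close> times the \<Phi>-sum, the other half of \<open>e\<close> being spent in
      \<open>split\<close>. The 1 keeps the denominator positive.\<close>
    define D where "D = max 1 (2 * C / e)"
    have "\<forall>\<^sub>F p in at_right q. D\<^sup>2 < F p \<Phi>"
      using assms(7) unfolding q_def by (simp add: filterlim_at_top_dense)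
    with near show "\<forall>\<^sub>F p in at_right q. dist (S \<Psi> p / S \<Phi> p) 0 < e"
    proof eventually_elim
      case (elim p)
      then have "D < S \<Phi> p" using S0(1)[of p] by (auto simp: F_S intro: power_less_imp_less_base)
      then have pos: "S \<Phi> p > 0" and "2 * C / e < S \<Phi> p" by (auto simp: D_def)
      then have "C < e / 2 * S \<Phi> p" using e by (simp add: field_simps)
      then have "S \<Psi> p < e * S \<Phi> p" using C[of p] elim by simp
      then show ?case using pos S0(2)[of p] elim by (simp add: dist_real_def pos_divide_less_eq)
    qed
  qed
  then have "((\<lambda>p. (S \<Psi> p / S \<Phi> p)\<^sup>2) \<longlongrightarrow> 0\<^sup>2) (at_right q)" by (rule tendsto_power)
  then show ?thesis by (simp add: F_S q_def power_divide)
qed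

end
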